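(* Let $\preceq$ be an admissible order on $\mathbb{IR}$ and let $S=(\alpha_i)_{i\in\mathbb{Z}^+}$ be an upper dense sequence in $]0,1]$. Then the relation $\unlhd^S$ on $\mathcal{F}(\mathbb{R})$ (built from $\preceq$ and $S$) is an admissible order on $\mathcal{F}(\mathbb{R})$.
   Context: $\mathbb{IR}=\{[a,b]: a,b\in\mathbb{R},\ a\le b\}$, with the partial order $[a,b]\leq_{KM}[c,d]\iff a\le c$ and $b\le d$. An admissible order on $\mathbb{IR}$ is a linear (total) order $\preceq$ on $\mathbb{IR}$ such that $X\leq_{KM}Y$ implies $X\preceq Y$; $\prec$ denotes its strict part. A fuzzy number is a function $A:\mathbb{R}\to[0,1]$ with $\sup_x A(x)=1$ such that, for every $\alpha\in\,]0,1]$, the $\alpha$-cut $A_\alpha=\{x\in\mathbb{R}:A(x)\ge\alpha\}$ is a closed interval, i.e. an element of $\mathbb{IR}$ (in particular nonempty), and the support $\{x:A(x)>0\}$ is bounded. $\mathcal{F}(\mathbb{R})$ is the set of all fuzzy numbers. The Klir–Yuan order on $\mathcal{F}(\mathbb{R})$ is $A\leq_{KY}B\iff A\wedge B=A$, where $(A\wedge B)(x)=\sup_{x=\min\{y,z\}}\min\{A(y),B(z)\}$; it is known that $A\leq_{KY}B$ iff $A_\alpha\leq_{KM}B_\alpha$ for all $\alpha\in\,]0,1]$. An admissible order on $\mathcal{F}(\mathbb{R})$ is a linear (total) order $\preceq'$ on $\mathcal{F}(\mathbb{R})$ such that $A\leq_{KY}B$ implies $A\preceq' B$. A sequence $S=(\alpha_i)_{i\in\mathbb{Z}^+}$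 in $]0,1]$ ($\mathbb{Z}^+$ the positive integers) is upper dense if for every $x\in\,]0,1]$ and every $\varepsilon>0$ there is $i\in\mathbb{Z}^+$ with $\alpha_i\in[x,x+\varepsilon[$. For $A\ne B$ in $\mathcal{F}(\mathbb{R})$, $m(A,B)=\min\{i\in\mathbb{Z}^+:A_{\alpha_i}\neq B_{\alpha_i}\}$ (well defined for upper dense $S$). Given an order $\preceq$ on $\mathbb{IR}$, define $A\unlhd^S B\iff A=B$ or ($A\neq B$ and $A_{\alpha_m}\prec B_{\alpha_m}$ with $m=m(A,B)$). *)

theory Defs
  imports "HOL-Analysis.Analysis"
begin

definition IR :: "real set set" where
  "IR = {{a..b} | a b. a \<le> b}"

definition KM_le :: "real set \<Rightarrow> real set \<Rightarrow> bool"  (infix "\<le>\<^sub>K\<^sub>M" 50) where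
  "X \<le>\<^sub>K\<^sub>M Y \<longleftrightarrow>
    (\<exists>a b c d. a \<le> b \<and> c \<le> d \<and> X = {a..b} \<and> Y = {c..d} \<and> a \<le> c \<and> b \<le> d)"

(* linear_order_on A r includes r \<subseteq> A \<times> A. *)
definition admissible_IR :: "real set rel \<Rightarrow> bool" where
  "admissible_IR r \<longleftrightarrow>
    linear_order_on IR r \<and> (\<forall>X\<in>IR. \<forall>Y\<in>IR. X \<le>\<^sub>K\<^sub>M Y \<longrightarrow> (X, Y) \<in> r)"

definition cut :: "(real \<Rightarrow> real) \<Rightarrow> real \<Rightarrow> real set" where
  "cut A \<alpha> = {x. \<alpha> \<le> A x}"

definition fuzzy_numbers :: "(real \<Rightarrow> real) set" where
  "fuzzy_numbers = {A. (\<forall>x. A x \<in> {0..1}) \<and> (SUP x. A x) = 1 \<and>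
    (\<forall>\<alpha>\<in>{0<..1}. cut A \<alpha> \<in> IR) \<and> bounded {x. A x > 0}}"

(* For functions into [0,1], the supremum is over a nonempty set (take y = z = x)
   bounded above by 1, so Sup on the reals is the genuine supremum. *)
definition fuzzy_meet :: "(real \<Rightarrow> real) \<Rightarrow> (real \<Rightarrow> real) \<Rightarrow> real \<Rightarrow> real" where
  "fuzzy_meet A B x = Sup {min (A y) (B z) | y z. x = min y z}"

definition KY_le :: "(real \<Rightarrow> real) \<Rightarrow> (real \<Rightarrow> real) \<Rightarrow> bool"  (infix "\<le>\<^sub>K\<^sub>Y" 50) where
  "A \<le>\<^sub>K\<^sub>Y B \<longleftrightarrow> fuzzy_meet A B = A"

definition admissible_fuzzy :: "(real \<Rightarrow> real) rel \<Rightarrow> bool" where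
  "admissible_fuzzy r \<longleftrightarrow>
    linear_order_on fuzzy_numbers r \<and>
    (\<forall>A\<in>fuzzy_numbers. \<forall>B\<in>fuzzy_numbers. A \<le>\<^sub>K\<^sub>Y B \<longrightarrow> (A, B) \<in> r)"

(* Sequences are indexed by the positive integers; the value at 0 is never used. *)
definition upper_dense :: "(nat \<Rightarrow> real) \<Rightarrow> bool" where
  "upper_dense S \<longleftrightarrow>
    (\<forall>i\<ge>1. S i \<in> {0<..1}) \<and>
    (\<forall>x\<in>{0<..1}. \<forall>\<epsilon>>0. \<exists>i\<ge>1. S i \<in> {x..<x + \<epsilon>})"

definition first_diff :: "(nat \<Rightarrow> real) \<Rightarrow> (real \<Rightarrow> real) \<Rightarrow> (real \<Rightarrow> real) \<Rightarrow> nat" where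
  "first_diff S A B = (LEAST i. i \<ge> 1 \<and> cut A (S i) \<noteq> cut B (S i))"

definition fuzzy_order :: "real set rel \<Rightarrow> (nat \<Rightarrow> real) \<Rightarrow> (real \<Rightarrow> real) rel" where
  "fuzzy_order r S = {(A, B). A \<in> fuzzy_numbers \<and> B \<in> fuzzy_numbers \<and>
    (A = B \<or>
     A \<noteq> B \<and>
     (let m = first_diff S A B
      in (cut A (S m), cut B (S m)) \<in> r \<and> cut A (S m) \<noteq> cut B (S m)))}"

end

theory Submission
  imports Defs
begin

text \<open>
  The relation is a lexicographic order: a fuzzy number is compared through the sequence of its
  cuts at the levels \<open>S 1\<close>, \<open>S 2\<close> and so on. The terms of an upper dense sequence meet every
  interval between two values \<open>A x < B x\<close>, and a level in between belongs to
  a cut that contains \<open>x\<close> for \<open>B\<close> but not for \<open>A\<close>. Hence the cuts along \<open>S\<close> determine the fuzzy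
  number (\<open>upper_dense_separates\<close>), the first difference exists, and
  reflexivity, antisymmetry, transitivity and totality are inherited from the order on intervals
  exactly as for any lexicographic order.

  Admissibility reduces to the fact that the Klir-Yuan order implies the Kulisch-Miranker order
  of all cuts (\<open>KY_le_cut\<close>). The delicate half is the right endpoint: the
  supremum defining the meet need not be attained, so knowing that every \<open>B z\<close> in it
  lies below \<open>\<alpha>\<close> is not enough. Beyond a cut, however, a fuzzy number decreases, and this bounds
  the supremum by a single value below \<open>\<alpha>\<close>.
\<close>

section \<open>The first level at which two fuzzy numbers differ\<close>

lemma fuzzy_numbersD:
  assumes "A \<in> fuzzy_numbers"
  shows "0 \<le> A x" "A x \<le> 1" "0 < \<alpha> \<Longrightarrow> \<alpha> \<le> 1 \<Longrightarrow> cut A \<alpha> \<in> IR"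
  using assms unfolding fuzzy_numbers_def by auto

text \<open>
  Upper density places a term in any half-open interval to the right of a given point, so it is
  applied at the midpoint of \<open>A x\<close> and \<open>B x\<close> to obtain a level strictly above the smaller value.
\<close>

lemma upper_dense_separates_less:
  assumes "upper_dense S" "0 \<le> A x" "B x \<le> 1" "A x < B x"
  shows "\<exists>i\<ge>1. cut A (S i) \<noteq> cut B (S i)"
proof -
  let ?y = "(A x + B x) / 2" and ?e = "(B x - A x) / 2"
  have "?y \<in> {0<..1}" "?e > 0"
    using assms by auto
  then obtain i where i: "i \<ge> 1" "S i \<in> {?y..<?y + ?e}"
    using assms(1) unfolding upper_dense_def by blast
  have "?y + ?e = B x"
    by (simp add: field_simps)
  with i(2) have "S i \<le> B x"
    by simp
  moreover have "A x < S i"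
    using i(2) assms(4) by simp
  ultimately have "x \<in> cut B (S i)" "x \<notin> cut A (S i)"
    by (auto simp: cut_def)
  with i(1) show ?thesis
    by blast
qed

lemma upper_dense_separates:
  assumes "upper_dense S" "A \<in> fuzzy_numbers" "B \<in> fuzzy_numbers" "A \<noteq> B"
  shows "\<exists>i\<ge>1. cut A (S i) \<noteq> cut B (S i)"
proof -
  from \<open>A \<noteq> B\<close> obtain x where "A x < B x \<or> B x < A x"
    by (metis ext linorder_neqE)
  then show ?thesis
    using upper_dense_separates_less[OF assms(1), of A x B]
      upper_dense_separates_less[OF assms(1), of B x A]
      fuzzy_numbersD(1,2)[OF assms(2), of x] fuzzy_numbersD(1,2)[OF assms(3), of x]
    by metis
qed

lemma first_diff_props:
  assumes "upper_dense S" "A \<in> fuzzy_numbers" "B \<in> fuzzy_numbers" "A \<noteq> B"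
  shows "first_diff S A B \<ge> 1"
    and "cut A (S (first_diff S A B)) \<noteq> cut B (S (first_diff S A B))"
    and "\<And>i. 1 \<le> i \<Longrightarrow> i < first_diff S A B \<Longrightarrow> cut A (S i) = cut B (S i)"
proof -
  let ?P = "\<lambda>i. i \<ge> 1 \<and> cut A (S i) \<noteq> cut B (S i)"
  have "\<exists>i. ?P i"
    using upper_dense_separates[OF assms] by blast
  then have "?P (LEAST i. ?P i)"
    by (rule LeastI_ex)
  then show "first_diff S A B \<ge> 1"
    and "cut A (S (first_diff S A B)) \<noteq> cut B (S (first_diff S A B))"
    unfolding first_diff_def by auto
  fix i assume "1 \<le> i" "i < first_diff S A B"
  then show "cut A (S i) = cut B (S i)"
    using not_less_Least[of i ?P] unfolding first_diff_def by blast
qed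

text \<open>
  Without the least index, transitivity becomes a comparison of two witnesses: the minimum of the
  witnesses for \<open>(A, B)\<close> and \<open>(B, C)\<close> is one for \<open>(A, C)\<close>.
\<close>

lemma fuzzy_order_iff:
  assumes "upper_dense S"
  shows "(A, B) \<in> fuzzy_order r S \<longleftrightarrow> A \<in> fuzzy_numbers \<and> B \<in> fuzzy_numbers \<and>
    (A = B \<or> (\<exists>m\<ge>1. (\<forall>i. 1 \<le> i \<and> i < m \<longrightarrow> cut A (S i) = cut B (S i)) \<and>
      (cut A (S m), cut B (S m)) \<in> r \<and> cut A (S m) \<noteq> cut B (S m)))"
proof -
  have fd: "first_diff S A B = m"
    if "m \<ge> 1" "\<forall>i. 1 \<le> i \<and> i < m \<longrightarrow> cut A (S i) = cut B (S i)" "cut A (S m) \<noteq> cut B (S m)"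
    for m
    unfolding first_diff_def
    by (rule Least_equality) (use that in \<open>auto simp: not_less[symmetric]\<close>)
  show ?thesis
  proof
    assume "(A, B) \<in> fuzzy_order r S"
    then show "A \<in> fuzzy_numbers \<and> B \<in> fuzzy_numbers \<and>
      (A = B \<or> (\<exists>m\<ge>1. (\<forall>i. 1 \<le> i \<and> i < m \<longrightarrow> cut A (S i) = cut B (S i)) \<and>
        (cut A (S m), cut B (S m)) \<in> r \<and> cut A (S m) \<noteq> cut B (S m)))"
      using first_diff_props[OF assms, of A B]
      unfolding fuzzy_order_def Let_def by blast
  next
    assume "A \<in> fuzzy_numbers \<and> B \<in> fuzzy_numbers \<and>
      (A = B \<or> (\<exists>m\<ge>1. (\<forall>i. 1 \<le> i \<and> i < m \<longrightarrow> cut A (S i) = cut B (S i)) \<and>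
        (cut A (S m), cut B (S m)) \<in> r \<and> cut A (S m) \<noteq> cut B (S m)))"
    then show "(A, B) \<in> fuzzy_order r S"
      using fd unfolding fuzzy_order_def Let_def by auto
  qed
qed

section \<open>The Klir-Yuan order and cuts\<close>

text \<open>
  Quasi-concavity: the cut at level \<open>B z\<close> is an interval with \<open>d\<close> and \<open>z\<close>, hence also \<open>b\<close>, in it.
  Level \<open>0\<close> has no such cut, but there the claim is trivial.
\<close>

lemma fuzzy_number_quasiconcave:
  assumes "B \<in> fuzzy_numbers" "d \<le> b" "b \<le> z" "B z \<le> B d"
  shows "B z \<le> B b"
proof (cases "B z > 0")
  case True
  then have "cut B (B z) \<in> IR"
    using fuzzy_numbersD[OF assms(1)] by blast
  then obtain p q where pq: "cut B (B z) = {p..q}"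
    unfolding IR_def by blast
  have "d \<in> {p..q}" "z \<in> {p..q}"
    unfolding pq[symmetric] cut_def using assms(4) by auto
  then have "b \<in> cut B (B z)"
    unfolding pq using assms(2,3) by auto
  then show ?thesis
    by (simp add: cut_def)
next
  case False
  then show ?thesis
    using fuzzy_numbersD(1)[OF assms(1), of b] by simp
qed

lemma fuzzy_meet_ge:
  assumes "A \<in> fuzzy_numbers"
  shows "min (A y) (B z) \<le> fuzzy_meet A B (min y z)"
  unfolding fuzzy_meet_def
proof (rule cSup_upper)
  show "bdd_above {min (A y') (B z') |y' z'. min y z = min y' z'}"
    by (rule bdd_aboveI[of _ 1]) (use fuzzy_numbersD(2)[OF assms] in \<open>auto simp: min_le_iff_disj\<close>)
qed blast

lemma KY_le_cut:
  assumes A: "A \<in> fuzzy_numbers" and B: "B \<in> fuzzy_numbers" and le: "A \<le>\<^sub>K\<^sub>Y B"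
    and \<alpha>: "0 < \<alpha>" "\<alpha> \<le> 1"
  shows "cut A \<alpha> \<le>\<^sub>K\<^sub>M cut B \<alpha>"
proof -
  obtain a b where ab: "a \<le> b" "cut A \<alpha> = {a..b}"
    using fuzzy_numbersD(3)[OF A \<alpha>] unfolding IR_def by blast
  obtain c d where cd: "c \<le> d" "cut B \<alpha> = {c..d}"
    using fuzzy_numbersD(3)[OF B \<alpha>] unfolding IR_def by blast
  have cutA: "\<alpha> \<le> A x \<longleftrightarrow> a \<le> x \<and> x \<le> b" for x
    using ab(2) by (auto simp: cut_def set_eq_iff)
  have cutB: "\<alpha> \<le> B x \<longleftrightarrow> c \<le> x \<and> x \<le> d" for x
    using cd(2) by (auto simp: cut_def set_eq_iff)
  have meet: "fuzzy_meet A B = A"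
    using le by (simp add: KY_le_def)
  have "a \<le> c"
  proof (rule ccontr)
    assume "\<not> a \<le> c"
    then have "min (A a) (B c) \<le> A c"
      using fuzzy_meet_ge[OF A, of a B c] meet by (simp add: min_def)
    moreover have "\<alpha> \<le> A a" "\<alpha> \<le> B c"
      using cutA cutB ab(1) cd(1) by auto
    ultimately have "\<alpha> \<le> A c"
      by linarith
    with cutA \<open>\<not> a \<le> c\<close> show False
      by blast
  qed
  moreover have "b \<le> d"
  proof (rule ccontr)
    assume "\<not> b \<le> d"
    then have db: "d < b"
      by simp
    have Bd: "\<alpha> \<le> B d"
      using cutB cd(1) by auto
    have "fuzzy_meet A B b \<le> B b"
      unfolding fuzzy_meet_def
    proof (rule cSup_least)
      have "min (A b) (B b) \<in> {min (A y) (B z) |y z. b = min y z}"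
        by (metis (mono_tags, lifting) mem_Collect_eq min.idem)
      then show "{min (A y) (B z) |y z. b = min y z} \<noteq> {}"
        by blast
    next
      fix v assume "v \<in> {min (A y) (B z) |y z. b = min y z}"
      then obtain y z where v: "v = min (A y) (B z)" and "b = min y z"
        by blast
      then have bz: "b \<le> z"
        by simp
      with db have "\<not> \<alpha> \<le> B z"
        using cutB by auto
      with Bd have "B z \<le> B d"
        by simp
      with db bz have "B z \<le> B b"
        using fuzzy_number_quasiconcave[OF B, of d b z] by simp
      then show "v \<le> B b"
        unfolding v by simp
    qed
    then have "A b \<le> B b"
      by (simp add: meet)
    moreover have "\<alpha> \<le> A b"
      using cutA ab(1) by simp
    ultimately have "\<alpha> \<le> B b"
      by linarith
    with cutB db show False
      by auto
  qed
  ultimately show ?thesis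
    unfolding KM_le_def using ab cd by blast
qed

section \<open>Admissibility of the lexicographic order\<close>

theorem mainTheorem1:
  fixes r :: "real set rel" and S :: "nat \<Rightarrow> real"
  assumes "admissible_IR r"
    and "upper_dense S"
  shows "admissible_fuzzy (fuzzy_order r S)"
proof -
  note iff = fuzzy_order_iff[OF assms(2)]
  note fd = first_diff_props[OF assms(2)]
  have lin: "linear_order_on IR r"
    and adm: "\<And>X Y. X \<in> IR \<Longrightarrow> Y \<in> IR \<Longrightarrow> X \<le>\<^sub>K\<^sub>M Y \<Longrightarrow> (X, Y) \<in> r"
    using assms(1) unfolding admissible_IR_def by auto
  from lin have trans_r: "trans r" and antisym_r: "antisym r" and total_r: "total_on IR r"
    by (auto simp: order_on_defs)
  have S: "0 < S i \<and> S i \<le> 1" if "i \<ge> 1" for i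
    using assms(2) that unfolding upper_dense_def by auto
  have cut_IR: "cut A (S i) \<in> IR" if "A \<in> fuzzy_numbers" "i \<ge> 1" for A i
    using fuzzy_numbersD(3)[OF that(1)] S[OF that(2)] by blast
  have "refl_on fuzzy_numbers (fuzzy_order r S)" "fuzzy_order r S \<subseteq> fuzzy_numbers \<times> fuzzy_numbers"
    unfolding refl_on_def fuzzy_order_def by auto
  moreover have "trans (fuzzy_order r S)"
  proof (rule transI)
    fix A B C assume AB: "(A, B) \<in> fuzzy_order r S" and BC: "(B, C) \<in> fuzzy_order r S"
    show "(A, C) \<in> fuzzy_order r S"
    proof (cases "A = B \<or> B = C")
      case True
      with AB BC show ?thesis
        by auto
    next
      case False
      from AB False obtain m where m: "m \<ge> 1"
        "\<And>i. 1 \<le> i \<Longrightarrow> i < m \<Longrightarrow> cut A (S i) = cut B (S i)"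
        "(cut A (S m), cut B (S m)) \<in> r" "cut A (S m) \<noteq> cut B (S m)"
        unfolding iff by blast
      from BC False obtain n where n: "n \<ge> 1"
        "\<And>i. 1 \<le> i \<Longrightarrow> i < n \<Longrightarrow> cut B (S i) = cut C (S i)"
        "(cut B (S n), cut C (S n)) \<in> r" "cut B (S n) \<noteq> cut C (S n)"
        unfolding iff by blast
      let ?k = "min m n"
      have "cut A (S i) = cut C (S i)" if "1 \<le> i" "i < ?k" for i
        using m(2) n(2) that by simp
      moreover have "(cut A (S ?k), cut C (S ?k)) \<in> r \<and> cut A (S ?k) \<noteq> cut C (S ?k)"
      proof (cases m n rule: linorder_cases)
        case less
        with m n(2)[of m] show ?thesis
          by (simp add: min_def)
      next
        case equal
        \<comment> \<open>Equal outer cuts would make the middle one equal to them by antisymmetry.\<close>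
        with m n show ?thesis
          by (metis antisymD antisym_r min.idem transD trans_r)
      next
        case greater
        with n m(2)[of n] show ?thesis
          by (simp add: min_def)
      qed
      moreover have "?k \<ge> 1" "A \<in> fuzzy_numbers" "C \<in> fuzzy_numbers"
        using m(1) n(1) AB BC unfolding iff by auto
      ultimately show ?thesis
        unfolding iff by blast
    qed
  qed
  moreover have "antisym (fuzzy_order r S)"
  proof (rule antisymI)
    fix A B assume AB: "(A, B) \<in> fuzzy_order r S" and BA: "(B, A) \<in> fuzzy_order r S"
    have sym: "first_diff S B A = first_diff S A B"
      unfolding first_diff_def by metis
    show "A = B"
    proof (rule ccontr)
      assume "A \<noteq> B"
      let ?m = "first_diff S A B"
      have "(cut A (S ?m), cut B (S ?m)) \<in> r" "cut A (S ?m) \<noteq> cut B (S ?m)"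
        using AB \<open>A \<noteq> B\<close> by (auto simp: fuzzy_order_def Let_def)
      moreover have "(cut B (S ?m), cut A (S ?m)) \<in> r"
        using BA \<open>A \<noteq> B\<close> by (auto simp: fuzzy_order_def Let_def sym)
      ultimately show False
        using antisym_r by (blast dest: antisymD)
    qed
  qed
  moreover have "total_on fuzzy_numbers (fuzzy_order r S)"
  proof (rule total_onI)
    fix A B assume AB: "A \<in> fuzzy_numbers" "B \<in> fuzzy_numbers" "A \<noteq> B"
    let ?m = "first_diff S A B"
    have "(cut A (S ?m), cut B (S ?m)) \<in> r \<or> (cut B (S ?m), cut A (S ?m)) \<in> r"
      using total_r cut_IR[OF AB(1) fd(1)[OF AB]] cut_IR[OF AB(2) fd(1)[OF AB]] fd(2)[OF AB]
      unfolding total_on_def by blast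
    then show "(A, B) \<in> fuzzy_order r S \<or> (B, A) \<in> fuzzy_order r S"
      using fd[OF AB] AB(1,2) unfolding iff by metis
  qed
  ultimately have "linear_order_on fuzzy_numbers (fuzzy_order r S)"
    by (simp add: order_on_defs)
  moreover have "(A, B) \<in> fuzzy_order r S"
    if AB: "A \<in> fuzzy_numbers" "B \<in> fuzzy_numbers" and le: "A \<le>\<^sub>K\<^sub>Y B" for A B
  proof (cases "A = B")
    case True
    with AB show ?thesis
      unfolding iff by blast
  next
    case False
    let ?m = "first_diff S A B"
    note m = fd[OF AB False]
    have "cut A (S ?m) \<le>\<^sub>K\<^sub>M cut B (S ?m)"
      using KY_le_cut[OF AB le] S[OF m(1)] by blast
    then have "(cut A (S ?m), cut B (S ?m)) \<in> r"
      using adm cut_IR[OF AB(1) m(1)] cut_IR[OF AB(2) m(1)] by blast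
    with m(2) AB show ?thesis
      unfolding fuzzy_order_def Let_def by blast
  qed
  ultimately show ?thesis
    unfolding admissible_fuzzy_def by blast
qed

end
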